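(* For any integer $k\ge 6$, with $h=\lfloor\frac{k-2}{2}\rfloor$, the number of $k$-caps in $\mathbb{Z}_2^n$ of dimension $k-2$ is \[ Q_{k-2}(k,n)=Q_{k-2}(k-1,n)\cdot\sum_{i=2}^{h}\frac{1}{2i+2}\binom{k-1}{2i+1} =Q_{k-2}(k-1,n)\left[\frac16\binom{k-1}{5}+\frac18\binom{k-1}{7}+\cdots+\frac{1}{2h+2}\binom{k-1}{2h+1}\right]. \]
   Context: $\mathbb{Z}_2^n$ is the $n$-dimensional vector space over $\mathbb{Z}_2$. A quad is a set of four distinct elements $a,b,c,d$ with $a+b+c+d=\vec 0$; a cap is a subset containing no quad; a $k$-cap is a cap with $k$ elements. Over $\mathbb{Z}_2$, affine combinations are sums of an odd number of elements and $\mathrm{aff}(S)$ is the set of affine combinations of elements of $S$. The dimension of a cap $C$ is the dimension of the flat $\mathrm{aff}(C)$. $Q_r(k,n)$ denotes the number of $k$-caps in $\mathbb{Z}_2^n$ of dimension $r$; in particular $Q_{k-2}(k-1,n)$ is the number of $(k-1)$-caps of dimension $k-2$, i.e. of affinely independent $(k-1)$-element subsets. *)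

theory Defs
  imports "HOL-Analysis.Cartesian_Space" "HOL-Library.Z2"
begin

text \<open>The space of dimension \<open>n\<close> over the two-element field is \<open>bit ^ 'n\<close>, where \<open>n = CARD('n)\<close>.\<close>

definition quad :: "(bit ^ 'n::finite) set \<Rightarrow> bool" where
  "quad A \<longleftrightarrow> (\<exists>a b c d. distinct [a, b, c, d] \<and> A = {a, b, c, d} \<and> a + b + c + d = 0)"

definition cap :: "(bit ^ 'n::finite) set \<Rightarrow> bool" where
  "cap C \<longleftrightarrow> (\<nexists>A. A \<subseteq> C \<and> quad A)"

text \<open>Coefficients lie in \<open>{0, 1}\<close> and must add up to \<open>1\<close>, so an affine combination is the sum
  over a subset of odd cardinality.\<close>

definition aff :: "(bit ^ 'n::finite) set \<Rightarrow> (bit ^ 'n) set" where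
  "aff S = {\<Sum>x\<in>T. x | T. T \<subseteq> S \<and> odd (card T)}"

text \<open>The dimension of a nonempty flat is the dimension of its direction space; as for
  \<open>aff_dim\<close>, the empty flat gets dimension \<open>-1\<close>.\<close>

definition flat_dim :: "(bit ^ 'n::finite) set \<Rightarrow> int" where
  "flat_dim F = (if F = {} then - 1 else int (vec.dim {x - y | x y. x \<in> F \<and> y \<in> F}))"

text \<open>\<open>num_caps r k TYPE('n)\<close> is \<open>Q\<^sub>r(k, n)\<close>.\<close>

definition num_caps :: "int \<Rightarrow> nat \<Rightarrow> 'n::finite itself \<Rightarrow> nat" where
  "num_caps r k n = card {C :: (bit ^ 'n) set. cap C \<and> card C = k \<and> flat_dim (aff C) = r}"

end

theory Submission imports Defs begin

text \<open>The even subsets of a nonempty set \<open>S\<close> form a group under symmetric difference, which the sum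
  maps onto the direction space of \<open>aff S\<close> with kernel \<open>zero_sums S\<close>. Hence \<open>S\<close> has dimension
  \<open>card S - 1\<close> iff no nonempty even subset sums to \<open>0\<close>, and dimension \<open>card S - 2\<close> iff exactly one,
  say \<open>D\<close>, does; such an \<open>S\<close> is a cap iff \<open>card D \<ge> 6\<close>. Sets of the second kind with
  \<open>card D = 2 * i + 2\<close> arise from an affinely independent set by adding the sum of \<open>2 * i + 1\<close> of its
  elements, each in \<open>2 * i + 2\<close> ways.\<close>

section \<open>Finiteness and characteristic-two arithmetic of the space\<close>

instance bit :: finite
proof
  have "(UNIV :: bit set) = {0, 1}"
    by (auto intro: bit_not_zero_iff[THEN iffD1])
  then show "finite (UNIV :: bit set)"
    by (metis finite.emptyI finite_insert)
qed

lemma vec_bit_add_self [simp]: "x + x = (0 :: bit ^ 'n)"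
  by (simp add: vec_eq_iff)

lemma vec_bit_add_self_left [simp]: "x + (x + y) = (y :: bit ^ 'n)"
  by (metis add.assoc add_0 vec_bit_add_self)

lemma vec_bit_minus [simp]: "- x = (x :: bit ^ 'n)"
  by (simp add: minus_unique)

lemma vec_bit_diff [simp]: "x - y = x + (y :: bit ^ 'n)"
  using diff_conv_add_uminus[of x y] by simp

lemma vec_bit_add_eq_0_iff: "x + y = 0 \<longleftrightarrow> x = (y :: bit ^ 'n)"
  using eq_neg_iff_add_eq_0[of x y] by simp

section \<open>Symmetric differences and even subsets\<close>

lemma sym_diff_eq_emptyD: "sym_diff A B = {} \<Longrightarrow> A = B"
  by blast

text \<open>The common part \<open>A \<inter> B\<close> occurs in both sums on the right and cancels
  in characteristic two.\<close>

lemma sum_sym_diff: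
  fixes A B :: "(bit ^ 'n::finite) set"
  shows "\<Sum>(sym_diff A B) = \<Sum>A + \<Sum>B"
proof -
  have "\<Sum>A = \<Sum>(A \<inter> B) + \<Sum>(A - B)"
    by (rule sum.Int_Diff) simp
  moreover have "\<Sum>B = \<Sum>(A \<inter> B) + \<Sum>(B - A)"
    by (subst Int_commute, rule sum.Int_Diff) simp
  moreover have "\<Sum>(sym_diff A B) = \<Sum>(A - B) + \<Sum>(B - A)"
    by (rule sum.union_disjoint) auto
  ultimately show ?thesis
    by (simp add: add.commute add.left_commute)
qed

lemma even_card_sym_diff:
  assumes "finite A" "finite B"
  shows "even (card (sym_diff A B)) \<longleftrightarrow> (even (card A) \<longleftrightarrow> even (card B))"
proof -
  have "card A = card (A \<inter> B) + card (A - B)" "card B = card (A \<inter> B) + card (B - A)"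
    using assms by (metis card_Int_Diff Int_commute)+
  moreover have "card (sym_diff A B) = card (A - B) + card (B - A)"
    using assms by (intro card_Un_disjoint) auto
  ultimately show ?thesis by presburger
qed

text \<open>Fix \<open>a\<close> in \<open>S\<close>. Deleting \<open>a\<close> maps the even
  subsets bijectively onto all subsets of \<open>S - {a}\<close>, since parity decides whether
  \<open>a\<close> has to be put back.\<close>

lemma card_even_subsets:
  assumes "finite S" "S \<noteq> {}"
  shows "card {T. T \<subseteq> S \<and> even (card T)} = 2 ^ (card S - 1)"
proof -
  obtain a where a: "a \<in> S" using assms by blast
  let ?f = "\<lambda>T. if even (card T) then T else insert a T"
  have fin: "T \<subseteq> S \<Longrightarrow> finite T" for T using assms finite_subset by blast
  have "bij_betw (\<lambda>T. T - {a}) {T. T \<subseteq> S \<and> even (card T)} (Pow (S - {a}))"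
  proof (rule bij_betw_byWitness[where f' = ?f])
    show "\<forall>T\<in>{T. T \<subseteq> S \<and> even (card T)}. ?f (T - {a}) = T"
      using fin by (auto simp: card_Diff_singleton_if card_gt_0_iff split: if_splits)
    show "\<forall>T\<in>Pow (S - {a}). ?f T - {a} = T" by auto
    show "(\<lambda>T. T - {a}) ` {T. T \<subseteq> S \<and> even (card T)} \<subseteq> Pow (S - {a})" by auto
    have "even (card (insert a T))" if "T \<subseteq> S - {a}" "odd (card T)" for T
      using that fin[of T] by (subst card_insert_disjoint) auto
    then show "?f ` Pow (S - {a}) \<subseteq> {T. T \<subseteq> S \<and> even (card T)}"
      using a by auto
  qed
  from bij_betw_same_card[OF this] show ?thesis
    using assms a by (simp add: card_Pow)
qed

section \<open>Cardinalities of subspaces\<close>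

lemma card_span_independent:
  fixes B :: "(bit ^ 'n::finite) set"
  assumes "vec.independent B"
  shows "card (vec.span B) = 2 ^ card B"
  using finite[of B] assms
proof (induction B rule: finite_induct)
  case (insert a B)
  then have a: "a \<notin> vec.span B" and B: "vec.independent B"
    using vec.independent_insert by metis+
  \<comment> \<open>The only scalars are 0 and 1, so the new span is the old one together with its
    translate by \<open>a\<close>. The two are disjoint because \<open>a\<close> lies outside the
    old span, so the size doubles.\<close>
  have "vec.span (insert a B) = vec.span B \<union> (+) a ` vec.span B"
  proof -
    have "x \<in> vec.span (insert a B) \<longleftrightarrow> x \<in> vec.span B \<or> x + a \<in> vec.span B" for x
      unfolding vec.span_insert
      by simp (metis (full_types) add.right_neutral bit_not_zero_iff vec.scale_one vec.scale_zero_left)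
    moreover have "x + a \<in> vec.span B \<longleftrightarrow> x \<in> (+) a ` vec.span B" for x
      by (auto simp: image_iff ac_simps) (metis add.commute vec_bit_add_self_left)
    ultimately show ?thesis by (simp only: set_eq_iff Un_iff simp_thms)
  qed
  moreover have "vec.span B \<inter> (+) a ` vec.span B = {}"
    using a vec.span_diff[of _ B] by (auto simp: ac_simps) (metis vec_bit_add_self_left add.commute)
  ultimately have "card (vec.span (insert a B)) = 2 * card (vec.span B)"
    by (simp add: card_Un_disjoint card_image)
  then show ?case using insert B by simp
qed simp

lemma card_subspace:
  fixes V :: "(bit ^ 'n::finite) set"
  assumes "vec.subspace V"
  shows "card V = 2 ^ vec.dim V"
proof -
  obtain B where B: "B \<subseteq> V" "vec.independent B" "V \<subseteq> vec.span B" "card B = vec.dim V"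
    using vec.basis_exists by blast
  then have "vec.span B = V"
    using vec.span_subspace assms by blast
  then show ?thesis
    using card_span_independent[OF B(2)] B(4) by simp
qed

section \<open>Dimension in terms of zero sums\<close>

definition zero_sums :: "(bit ^ 'n::finite) set \<Rightarrow> (bit ^ 'n) set set" where
  "zero_sums S = {T. T \<subseteq> S \<and> even (card T) \<and> \<Sum>T = 0}"

definition even_sums :: "(bit ^ 'n::finite) set \<Rightarrow> (bit ^ 'n) set" where
  "even_sums S = Sum ` {T. T \<subseteq> S \<and> even (card T)}"

lemma subspace_even_sums: "vec.subspace (even_sums S)"
proof (rule vec.subspaceI)
  show "0 \<in> even_sums S"
    unfolding even_sums_def by (auto intro!: image_eqI[where x = "{}"])
  show "x + y \<in> even_sums S" if xy: "x \<in> even_sums S" "y \<in> even_sums S" for x y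
  proof -
    obtain T U where "T \<subseteq> S" "U \<subseteq> S" "even (card T)" "even (card U)" "x = \<Sum>T" "y = \<Sum>U"
      using xy unfolding even_sums_def by auto
    then show ?thesis
      unfolding even_sums_def
      by (intro image_eqI[where x = "sym_diff T U"]) (auto simp: sum_sym_diff even_card_sym_diff)
  qed
  then show "c *s x \<in> even_sums S" if "x \<in> even_sums S" for c x
    using that \<open>0 \<in> even_sums S\<close> by (cases "c = 0") auto
qed

lemma affI: "T \<subseteq> S \<Longrightarrow> odd (card T) \<Longrightarrow> \<Sum>T \<in> aff S"
  unfolding aff_def by blast

lemma aff_differences:
  assumes "S \<noteq> {}"
  shows "{x - y | x y. x \<in> aff S \<and> y \<in> aff S} = even_sums S"
proof (intro equalityI subsetI)
  fix z assume "z \<in> {x - y | x y. x \<in> aff S \<and> y \<in> aff S}"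
  then obtain T U where "T \<subseteq> S" "U \<subseteq> S" "odd (card T)" "odd (card U)" "z = \<Sum>T + \<Sum>U"
    unfolding aff_def by auto
  then show "z \<in> even_sums S"
    unfolding even_sums_def
    by (intro image_eqI[where x = "sym_diff T U"]) (auto simp: sum_sym_diff even_card_sym_diff)
next
  fix z assume "z \<in> even_sums S"
  then obtain T where T: "T \<subseteq> S" "even (card T)" "z = \<Sum>T"
    unfolding even_sums_def by auto
  obtain a where a: "a \<in> S" using assms by blast
  \<comment> \<open>Toggling one point \<open>a\<close> makes the even set \<open>T\<close> odd, so
    its sum becomes an affine combination; subtracting \<open>a\<close> recovers
    \<open>z\<close>.\<close>
  have "\<Sum>(sym_diff T {a}) \<in> aff S"
    by (rule affI) (use T a even_card_sym_diff[of T "{a}"] in auto)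
  moreover have "\<Sum>{a} \<in> aff S"
    by (rule affI) (use a in auto)
  moreover have "z = \<Sum>(sym_diff T {a}) - \<Sum>{a}"
    unfolding sum_sym_diff using T by (simp add: add.assoc)
  ultimately show "z \<in> {x - y | x y. x \<in> aff S \<and> y \<in> aff S}" by blast
qed

text \<open>Rank-nullity for the sum map on even subsets, whose fibres are translates of
  \<^term>\<open>zero_sums S\<close> under symmetric difference.\<close>

lemma card_even_sums:
  fixes S :: "(bit ^ 'n::finite) set"
  assumes "S \<noteq> {}"
  shows "card (even_sums S) * card (zero_sums S) = 2 ^ (card S - 1)"
proof -
  let ?E = "{T. T \<subseteq> S \<and> even (card T)}"
  have fibre: "card {T \<in> ?E. \<Sum>T = v} = card (zero_sums S)" if v: "v \<in> even_sums S" for v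
  proof -
    obtain U where U: "U \<subseteq> S" "even (card U)" "v = \<Sum>U"
      using v unfolding even_sums_def by auto
    have inv: "sym_diff (sym_diff T U) U = T" for T by blast
    have "bij_betw (\<lambda>T. sym_diff T U) {T \<in> ?E. \<Sum>T = v} (zero_sums S)"
    proof (rule bij_betw_byWitness[where f' = "\<lambda>T. sym_diff T U"])
      show "(\<lambda>T. sym_diff T U) ` {T \<in> ?E. \<Sum>T = v} \<subseteq> zero_sums S"
        using U by (auto simp: zero_sums_def sum_sym_diff even_card_sym_diff)
      show "(\<lambda>T. sym_diff T U) ` zero_sums S \<subseteq> {T \<in> ?E. \<Sum>T = v}"
        using U by (auto simp: zero_sums_def sum_sym_diff even_card_sym_diff)
    qed (use inv in blast)+
    then show ?thesis by (rule bij_betw_same_card)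
  qed
  have "card ?E = (\<Sum>v\<in>even_sums S. card {T \<in> ?E. \<Sum>T = v})"
    using sum.image_gen[of ?E "\<lambda>_. 1 :: nat" Sum] by (simp add: even_sums_def)
  also have "\<dots> = card (even_sums S) * card (zero_sums S)"
    using fibre by simp
  finally show ?thesis using card_even_subsets[OF finite assms] by simp
qed

lemma flat_dim_aff:
  fixes S :: "(bit ^ 'n::finite) set"
  assumes "S \<noteq> {}"
  shows "flat_dim (aff S) = int (vec.dim (even_sums S))"
proof -
  obtain a where "a \<in> S" using assms by blast
  then have "aff S \<noteq> {}"
    using affI[of "{a}" S] by auto
  then show ?thesis
    unfolding flat_dim_def aff_differences[OF assms] by simp
qed

text \<open>Here \<open>j\<close> is the defect from affine independence. Since the direction space
  has size \<open>2 ^ dim\<close>, rank-nullity turns a defect \<open>j\<close> into a kernel of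
  size \<open>2 ^ j\<close>. The bound on \<open>j\<close> keeps the natural subtraction
  \<open>card S - 1 - j\<close> exact.\<close>

lemma flat_dim_eq_iff:
  fixes S :: "(bit ^ 'n::finite) set"
  assumes "j < card S"
  shows "flat_dim (aff S) = int (card S) - 1 - int j \<longleftrightarrow> card (zero_sums S) = 2 ^ j"
proof -
  have S: "S \<noteq> {}" using assms by auto
  let ?d = "vec.dim (even_sums S)"
  have eq: "2 ^ ?d * card (zero_sums S) = 2 ^ (card S - 1)"
    using card_even_sums[OF S] card_subspace[OF subspace_even_sums, of S] by simp
  have split: "(2::nat) ^ (card S - 1) = 2 ^ (card S - 1 - j) * 2 ^ j"
    using assms by (simp flip: power_add)
  have "flat_dim (aff S) = int (card S) - 1 - int j \<longleftrightarrow> ?d = card S - 1 - j"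
    unfolding flat_dim_aff[OF S] using assms by linarith
  also have "\<dots> \<longleftrightarrow> card (zero_sums S) = 2 ^ j"
  proof
    assume "?d = card S - 1 - j"
    then show "card (zero_sums S) = 2 ^ j" using eq split by simp
  next
    assume "card (zero_sums S) = 2 ^ j"
    then have "(2::nat) ^ ?d = 2 ^ (card S - 1 - j)" using eq split by simp
    then show "?d = card S - 1 - j" by simp
  qed
  finally show ?thesis .
qed

lemma empty_in_zero_sums: "{} \<in> zero_sums S"
  by (simp add: zero_sums_def)

text \<open>The ambient sets \<open>R\<close> and \<open>S\<close> are kept apart so that, when an
  element common to \<open>T\<close> and \<open>U\<close> cancels, the result can be placed in a
  smaller set.\<close>

lemma zero_sums_sym_diff:
  "sym_diff T U \<in> zero_sums S"
  if "T \<in> zero_sums R" "U \<in> zero_sums R" "sym_diff T U \<subseteq> S"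
  using that by (auto simp: zero_sums_def sum_sym_diff even_card_sym_diff)

lemma card_zero_sums_eq_1_iff: "card (zero_sums S) = 1 \<longleftrightarrow> zero_sums S = {{}}"
  using empty_in_zero_sums[of S] by (auto simp: card_1_singleton_iff)

lemma card_zero_sums_eq_2_iff:
  "card (zero_sums S) = 2 \<longleftrightarrow> (\<exists>D. D \<noteq> {} \<and> zero_sums S = {{}, D})"
proof
  assume "card (zero_sums S) = 2"
  then have "card (zero_sums S - {{}}) = 1"
    using card_Diff_singleton[OF empty_in_zero_sums[of S]] by simp
  then obtain D where "zero_sums S - {{}} = {D}" by (auto simp: card_1_singleton_iff)
  then have "D \<noteq> {}" "zero_sums S = {{}, D}"
    using empty_in_zero_sums by blast+
  then show "\<exists>D. D \<noteq> {} \<and> zero_sums S = {{}, D}" by blast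
qed (auto simp: card_2_iff)

section \<open>Quads and caps as conditions on zero sums\<close>

lemma quad_iff: "quad A \<longleftrightarrow> card A = 4 \<and> \<Sum>A = 0"
proof
  assume "quad A"
  then show "card A = 4 \<and> \<Sum>A = 0"
    unfolding quad_def by (auto simp: add.assoc)
next
  assume A: "card A = 4 \<and> \<Sum>A = 0"
  then have "card A = Suc 3" by simp
  then obtain a B where "A = insert a B" "a \<notin> B" "card B = 3"
    by (metis card_Suc_eq)
  moreover then obtain b c d where "B = {b, c, d}" "b \<noteq> c" "c \<noteq> d" "b \<noteq> d"
    by (metis card_3_iff)
  ultimately have "distinct [a, b, c, d] \<and> A = {a, b, c, d} \<and> a + b + c + d = 0"
    using A by (auto simp: add.assoc)
  then show "quad A" unfolding quad_def by (intro exI)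
qed

lemma cap_iff: "cap C \<longleftrightarrow> (\<forall>T\<in>zero_sums C. card T \<noteq> 4)"
  unfolding cap_def quad_iff zero_sums_def by auto

text \<open>In characteristic two, \<open>x + y = 0\<close> forces \<open>x = y\<close>. Together
  with the cap condition and parity, this leaves only sizes of at least 6 for a nonempty zero
  sum.\<close>

lemma card_zero_sums_member_neq_2:
  assumes "T \<in> zero_sums S"
  shows "card T \<noteq> 2"
proof
  assume "card T = 2"
  then obtain x y where "T = {x, y}" "x \<noteq> y" by (meson card_2_iff)
  then show False using assms by (simp add: zero_sums_def vec_bit_add_eq_0_iff)
qed

section \<open>Removing and adding one point\<close>

lemma zero_sums_remove:
  assumes "zero_sums C = {{}, D}" "x \<in> D"
  shows "zero_sums (C - {x}) = {{}}"
proof -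
  have "zero_sums (C - {x}) \<subseteq> zero_sums C - {D}"
    using assms(2) unfolding zero_sums_def by auto
  then show ?thesis using assms(1) empty_in_zero_sums[of "C - {x}"] by auto
qed

text \<open>Two zero sums through the new point differ by a zero sum inside \<open>I\<close>, which
  must be empty; so the evident one, \<open>insert (\<Sum>T) T\<close>, is the only one.\<close>

lemma zero_sums_insert_sum:
  fixes I :: "(bit ^ 'n::finite) set"
  assumes I: "zero_sums I = {{}}" and T: "T \<subseteq> I" "odd (card T)" "card T \<noteq> 1"
  shows "\<Sum>T \<notin> I" and "zero_sums (insert (\<Sum>T) I) = {{}, insert (\<Sum>T) T}"
proof -
  let ?x = "\<Sum>T"
  show x: "?x \<notin> I"
  proof
    assume "?x \<in> I"
    \<comment> \<open>If the sum already lay in \<open>I\<close>, toggling it in \<open>T\<close>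
      would give a zero sum inside \<open>I\<close>. This would force \<open>T = {\<Sum>T}\<close>,
      contrary to \<open>card T \<noteq> 1\<close>.\<close>
    moreover have "\<Sum>(sym_diff T {?x}) = 0"
      unfolding sum_sym_diff by simp
    moreover have "even (card (sym_diff T {?x}))"
      using T even_card_sym_diff[of T "{?x}"] by simp
    ultimately have "sym_diff T {?x} \<in> zero_sums I"
      unfolding zero_sums_def using T by blast
    then have "sym_diff T {?x} = {}"
      unfolding I by (simp only: singleton_iff)
    then have "T = {?x}" by (rule sym_diff_eq_emptyD)
    then have "card T = card {?x}" by (rule arg_cong)
    then show False using T(3) by simp
  qed
  then have "?x \<notin> T" using T by blast
  then have D: "insert ?x T \<in> zero_sums (insert ?x I)"
    using T by (auto simp: zero_sums_def)
  have "U = insert ?x T" if U: "U \<in> zero_sums (insert ?x I)" "?x \<in> U" for U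
  proof -
    have "sym_diff U (insert ?x T) \<in> zero_sums I"
      using U T by (intro zero_sums_sym_diff[OF U(1) D]) (auto simp: zero_sums_def)
    then have "sym_diff U (insert ?x T) = {}"
      unfolding I by (simp only: singleton_iff)
    then show ?thesis by (rule sym_diff_eq_emptyD)
  qed
  moreover have "U = {}" if "U \<in> zero_sums (insert ?x I)" "?x \<notin> U" for U
  proof -
    have "U \<in> zero_sums I" using that by (auto simp: zero_sums_def)
    then show ?thesis using I by simp
  qed
  ultimately show "zero_sums (insert ?x I) = {{}, insert ?x T}"
    using D empty_in_zero_sums by blast
qed

text \<open>Double counting of the ways to remove one element \<open>x\<close> of the unique nonempty zero sum \<open>D\<close>:
  what remains is affinely independent and, together with \<open>D - {x}\<close>, determines \<open>x\<close>.\<close>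

lemma card_unique_zero_sum:
  fixes k m :: nat
  assumes m: "even m" "m > 2"
  shows "card {C :: (bit ^ 'n::finite) set. card C = k \<and> (\<exists>D. zero_sums C = {{}, D} \<and> card D = m)} * m =
    card {I :: (bit ^ 'n) set. card I = k - 1 \<and> zero_sums I = {{}}} * ((k - 1) choose (m - 1))"
    (is "card ?K * m = card ?J * _")
\<comment> \<open>For \<open>k = 0\<close> the subtraction \<open>k - 1\<close> truncates. Both
  sides then vanish: no \<open>D\<close> of size \<open>m\<close> fits into an empty set, and the
  binomial coefficient is \<open>0 choose (m - 1)\<close> with \<open>m > 2\<close>.\<close>
proof (cases "k = 0")
  case True
  have "?K = {}"
  proof -
    have False if "card C = k" "zero_sums C = {{}, D}" "card D = m" for C D :: "(bit ^ 'n) set"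
    proof -
      have "D \<in> zero_sums C" using that by simp
      then have "D \<subseteq> C" by (simp add: zero_sums_def)
      then show False using that True m by auto
    qed
    then show ?thesis by blast
  qed
  then show ?thesis using True m by (simp only: card.empty) simp
next
  case k: False
  \<comment> \<open>The union of all zero sums names the unique nonempty one without a choice,
    because the other member is empty.\<close>
  let ?D = "\<lambda>C :: (bit ^ 'n) set. \<Union>(zero_sums C)"
  let ?T = "\<lambda>I :: (bit ^ 'n) set. {T. T \<subseteq> I \<and> card T = m - 1}"
  let ?f = "\<lambda>(C, x). (C - {x}, ?D C - {x})"
  let ?g = "\<lambda>(I, T). (insert (\<Sum>T) I, \<Sum>T)"
  have K: "zero_sums C = {{}, ?D C}" "card (?D C) = m" "card C = k"
    "?D C \<subseteq> C" "\<Sum>(?D C) = 0" if C: "C \<in> ?K" for C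
  proof -
    obtain D where D: "zero_sums C = {{}, D}" "card D = m" using C by blast
    then have "?D C = D" by simp
    then show "zero_sums C = {{}, ?D C}" "card (?D C) = m" "card C = k"
      using C D by auto
    have "D \<in> zero_sums C" using D by simp
    then show "?D C \<subseteq> C" "\<Sum>(?D C) = 0"
      unfolding \<open>?D C = D\<close> by (auto simp: zero_sums_def)
  qed
  \<comment> \<open>The elements of \<open>?D C\<close> add up to 0, so each is the sum of the
    others; this lets \<open>?g\<close> recover the deleted point.\<close>
  have sum_rest: "\<Sum>(?D C - {x}) = x" if "C \<in> ?K" "x \<in> ?D C" for C x
  proof -
    have "x + \<Sum>(?D C - {x}) = 0"
      using K(5)[OF that(1)] sum.remove[OF finite that(2), of "\<lambda>y. y"] by simp
    then show ?thesis by (simp add: vec_bit_add_eq_0_iff)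
  qed
  have J: "\<Sum>T \<notin> I" "zero_sums (insert (\<Sum>T) I) = {{}, insert (\<Sum>T) T}"
    "\<Sum>T \<notin> T" if "I \<in> ?J" "T \<in> ?T I" for I T
  proof -
    have "zero_sums I = {{}}" "T \<subseteq> I" "odd (card T)" "card T \<noteq> 1"
      using that m by auto
    from zero_sums_insert_sum[OF this] \<open>T \<subseteq> I\<close>
    show "\<Sum>T \<notin> I" "zero_sums (insert (\<Sum>T) I) = {{}, insert (\<Sum>T) T}" "\<Sum>T \<notin> T"
      by auto
  qed
  have "bij_betw ?f (Sigma ?K ?D) (Sigma ?J ?T)"
  proof (rule bij_betw_byWitness[where f' = ?g])
    show "\<forall>p\<in>Sigma ?K ?D. ?g (?f p) = p"
    proof
      fix p assume "p \<in> Sigma ?K ?D"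
      then obtain C x where p: "p = (C, x)" "C \<in> ?K" "x \<in> ?D C" by (elim SigmaE)
      then have "insert x (C - {x}) = C" using K(4)[OF p(2)] by (simp only: insert_Diff subsetD)
      then show "?g (?f p) = p"
        unfolding p(1) prod.case sum_rest[OF p(2,3)] by (rule arg_cong)
    qed
    show "\<forall>p\<in>Sigma ?J ?T. ?f (?g p) = p"
    proof
      fix p assume "p \<in> Sigma ?J ?T"
      then obtain I T where p: "p = (I, T)" "I \<in> ?J" "T \<in> ?T I" by (elim SigmaE)
      show "?f (?g p) = p"
        unfolding p(1) prod.case J(2)[OF p(2,3)] using J(1,3)[OF p(2,3)] by simp
    qed
    show "?f ` Sigma ?K ?D \<subseteq> Sigma ?J ?T"
    proof (rule image_subsetI)
      fix p assume "p \<in> Sigma ?K ?D"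
      then obtain C x where p: "p = (C, x)" "C \<in> ?K" "x \<in> ?D C" by (elim SigmaE)
      have "x \<in> C" using K(4)[OF p(2)] p(3) by (rule subsetD)
      then have "C - {x} \<in> ?J"
        using zero_sums_remove[OF K(1)[OF p(2)] p(3)] K(3)[OF p(2)] by simp
      moreover have "?D C - {x} \<in> ?T (C - {x})"
        using p(3) K(2,4)[OF p(2)] by (simp only: mem_Collect_eq card_Diff_singleton Diff_mono order_refl simp_thms)
      ultimately show "?f p \<in> Sigma ?J ?T"
        unfolding p(1) prod.case by (rule SigmaI)
    qed
    show "?g ` Sigma ?J ?T \<subseteq> Sigma ?K ?D"
    proof (rule image_subsetI)
      fix p assume "p \<in> Sigma ?J ?T"
      then obtain I T where p: "p = (I, T)" "I \<in> ?J" "T \<in> ?T I" by (elim SigmaE)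
      note J = J[OF p(2,3)]
      have "card (insert (\<Sum>T) T) = m" "card (insert (\<Sum>T) I) = k"
        using p(2,3) J(1,3) m k by simp_all
      then have "insert (\<Sum>T) I \<in> ?K" using J(2) by blast
      moreover have "\<Sum>T \<in> ?D (insert (\<Sum>T) I)" unfolding J(2) by simp
      ultimately show "?g p \<in> Sigma ?K ?D"
        unfolding p(1) prod.case by (rule SigmaI)
    qed
  qed
  then have "card (Sigma ?K ?D) = card (Sigma ?J ?T)" by (rule bij_betw_same_card)
  \<comment> \<open>Both families of pairs have fibres of constant size: \<open>m\<close> points to
    delete on one side, the subsets of size \<open>m - 1\<close> of a set of size
    \<open>k - 1\<close> on the other.\<close>
  moreover have "card (Sigma ?K ?D) = card ?K * m"
    by (subst card_SigmaI) (simp_all add: K(2))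
  moreover have "card (Sigma ?J ?T) = card ?J * ((k - 1) choose (m - 1))"
    by (subst card_SigmaI) (simp_all add: n_subsets)
  ultimately show ?thesis by simp
qed

section \<open>Classifying the caps by the size of their zero sum, and summing up\<close>

theorem theorem7p5:
  fixes k h :: nat
  assumes "k \<ge> 6" and "h = (k - 2) div 2"
  shows "real (num_caps (int k - 2) k TYPE('n::finite)) =
    real (num_caps (int k - 2) (k - 1) TYPE('n)) *
      (\<Sum>i=2..h. 1 / real (2 * i + 2) * real ((k - 1) choose (2 * i + 1)))"
proof -
  let ?J = "{I :: (bit ^ 'n) set. card I = k - 1 \<and> zero_sums I = {{}}}"
  define K where
    "K m = {C :: (bit ^ 'n) set. card C = k \<and> (\<exists>D. zero_sums C = {{}, D} \<and> card D = m)}" for m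
  \<comment> \<open>For \<open>k - 1\<close> points, dimension \<open>k - 2\<close> is defect 0. The
    only zero sum is then empty, so such a set is automatically a cap.\<close>
  have "cap I \<and> card I = k - 1 \<and> flat_dim (aff I) = int k - 2 \<longleftrightarrow> card I = k - 1 \<and> zero_sums I = {{}}"
    for I :: "(bit ^ 'n) set"
  proof -
    have "flat_dim (aff I) = int k - 2 \<longleftrightarrow> zero_sums I = {{}}" if "card I = k - 1"
      using assms(1) that flat_dim_eq_iff[of 0 I] card_zero_sums_eq_1_iff[of I] by (simp add: of_nat_diff)
    moreover have "cap I" if "zero_sums I = {{}}"
      unfolding cap_iff that by simp
    ultimately show ?thesis by blast
  qed
  then have J: "num_caps (int k - 2) (k - 1) TYPE('n) = card ?J"
    unfolding num_caps_def by simp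
  \<comment> \<open>For \<open>k\<close> points the same dimension is defect 1, a kernel of size
    2.\<close>
  have dim_iff: "flat_dim (aff C) = int k - 2 \<longleftrightarrow> (\<exists>D. D \<noteq> {} \<and> zero_sums C = {{}, D})"
    if "card C = k" for C :: "(bit ^ 'n) set"
    using assms(1) that flat_dim_eq_iff[of 1 C] card_zero_sums_eq_2_iff[of C] by simp
  have "{C :: (bit ^ 'n) set. cap C \<and> card C = k \<and> flat_dim (aff C) = int k - 2} =
    (\<Union>i\<in>{2..h}. K (2 * i + 2))" (is "?L = ?R")
  proof (intro equalityI subsetI)
    fix C assume "C \<in> ?L"
    then have C: "cap C" "card C = k" and "flat_dim (aff C) = int k - 2" by simp_all
    then obtain D where D: "D \<noteq> {}" "zero_sums C = {{}, D}"
      unfolding dim_iff[OF C(2)] by (elim exE conjE)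
    then have DC: "D \<in> zero_sums C" by simp
    then have "D \<subseteq> C" "even (card D)" by (auto simp: zero_sums_def)
    have "card D \<le> k" using \<open>D \<subseteq> C\<close> C(2) by (metis card_mono finite)
    moreover have "card D \<noteq> 0" using D(1) by simp
    moreover have "card D \<noteq> 2" using DC by (rule card_zero_sums_member_neq_2)
    moreover have "card D \<noteq> 4" using DC C(1) unfolding cap_iff by blast
    \<comment> \<open>An even size other than 0, 2 and 4 is at least 6, which is
      \<open>2 * i + 2\<close> at \<open>i = 2\<close>. The bound \<open>k\<close> gives the upper
      limit, as \<open>h\<close> is the largest \<open>i\<close> with
      \<open>2 * i + 2 \<le> k\<close>.\<close>
    ultimately have "\<exists>i\<ge>2. card D = 2 * i + 2 \<and> 2 * i + 2 \<le> k"
      using \<open>even (card D)\<close> by presburger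
    then obtain i where i: "card D = 2 * i + 2" "i \<ge> 2" "2 * i + 2 \<le> k" by blast
    then have "i \<in> {2..h}"
      unfolding assms(2) by simp
    moreover have "C \<in> K (2 * i + 2)"
      unfolding K_def using C D i by blast
    ultimately show "C \<in> ?R" by (rule UN_I)
  next
    fix C assume "C \<in> ?R"
    obtain i D where i: "i \<ge> 2" and C: "card C = k"
      and D: "zero_sums C = {{}, D}" "card D = 2 * i + 2"
      using \<open>C \<in> ?R\<close> unfolding K_def by auto
    have "D \<noteq> {}" using D(2) by auto
    then have "flat_dim (aff C) = int k - 2"
      unfolding dim_iff[OF C] using D(1) by (intro exI conjI)
    moreover have "cap C" unfolding cap_iff D(1) using D(2) i by simp
    ultimately show "C \<in> ?L" using C by simp
  qed
  then have "num_caps (int k - 2) k TYPE('n) = card ?R"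
    unfolding num_caps_def by simp
  also have "\<dots> = (\<Sum>i=2..h. card (K (2 * i + 2)))"
  proof (rule card_UN_disjoint)
    \<comment> \<open>A set in both classes would have one nonempty zero sum \<open>D\<close> of two
      different sizes.\<close>
    show "\<forall>i\<in>{2..h}. \<forall>j\<in>{2..h}. i \<noteq> j \<longrightarrow> K (2 * i + 2) \<inter> K (2 * j + 2) = {}"
      unfolding K_def by (auto simp: doubleton_eq_iff)
  qed auto
  finally have "real (num_caps (int k - 2) k TYPE('n)) = (\<Sum>i=2..h. real (card (K (2 * i + 2))))"
    by simp
  also have "\<dots> = (\<Sum>i=2..h. real (card ?J) * (1 / real (2 * i + 2) * real ((k - 1) choose (2 * i + 1))))"
  proof (rule sum.cong)
    fix i assume "i \<in> {2..h}"
    then have m: "even (2 * i + 2)" "2 * i + 2 > 2" and "2 * i + 2 - 1 = 2 * i + 1" by simp_all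
    \<comment> \<open>The double count with \<open>m = 2 * i + 2\<close>; dividing by
      \<open>m\<close> produces the fraction in the summand.\<close>
    then have "card (K (2 * i + 2)) * (2 * i + 2) = card ?J * ((k - 1) choose (2 * i + 1))"
      unfolding K_def using card_unique_zero_sum[where 'n = 'n, OF m, of k] by (simp only:)
    then have "real (card (K (2 * i + 2))) * real (2 * i + 2) =
      real (card ?J) * real ((k - 1) choose (2 * i + 1))"
      by (simp only: of_nat_mult[symmetric])
    then show "real (card (K (2 * i + 2))) =
      real (card ?J) * (1 / real (2 * i + 2) * real ((k - 1) choose (2 * i + 1)))"
      using m(2) by (simp add: eq_divide_eq del: of_nat_add of_nat_mult)
  qed simp
  finally show ?thesis unfolding J sum_distrib_left .
qed

end
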